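(* It is not true that every finite simple oriented graph admits a sequence of edge-flips which monotonically decreases the number of directed 3-cycles to zero. That is, there exists a finite simple oriented graph $G$ for which there is no finite sequence of graphs $G=G_0,G_1,\dots,G_k$ ($k\ge 0$) such that each $G_{i+1}$ is obtained from $G_i$ by a single edge-flip, the number of directed 3-cycles of $G_{i+1}$ is at most the number of directed 3-cycles of $G_i$ for all $0\le i<k$, and $G_k$ has no directed 3-cycles.
   Context: A finite simple oriented graph is a pair $G=(V,E)$ with $V$ a finite set and $E\subseteq\{(i,j)\in V\times V : i\neq j\}$ such that $(i,j)\in E$ implies $(j,i)\notin E$. Vertices $a,b,c\in V$ form a (directed) 3-cycle iff $(a,b),(b,c),(c,a)\in E$; 3-cycles are counted up to cyclic rotation. An edge-flip of an edge $(i,j)\in E$ replaces the edge $(i,j)$ by $(j,i)$ and leaves all other edges unchanged. "Monotonically decreases" means that the number never increases along the sequence. *)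

theory Defs
  imports "Graph_Theory.Pair_Digraph"
begin

text \<open>
  The library locale \<open>pair_digraph\<close> gives a finite vertex set and a finite, loop-free set
  of arcs between vertices; an oriented graph additionally has no two opposite arcs.
\<close>

locale oriented_graph = pair_digraph G for G :: "'a pair_pre_digraph" +
  assumes no_opposite_arcs: "(i, j) \<in> parcs G \<Longrightarrow> (j, i) \<notin> parcs G"

definition three_cycle_triples :: "'a pair_pre_digraph \<Rightarrow> ('a \<times> 'a \<times> 'a) set" where
  "three_cycle_triples G =
     {(a, b, c). a \<in> pverts G \<and> b \<in> pverts G \<and> c \<in> pverts G \<and>
        (a, b) \<in> parcs G \<and> (b, c) \<in> parcs G \<and> (c, a) \<in> parcs G}"

definition rotation_rel :: "('a \<times> 'a \<times> 'a) rel" where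
  "rotation_rel =
     {((a, b, c), t) | a b c t. t = (a, b, c) \<or> t = (b, c, a) \<or> t = (c, a, b)}"

lemma equiv_rotation_rel: "equiv UNIV rotation_rel"
  unfolding equiv_def refl_on_def sym_def trans_def rotation_rel_def by auto

definition num_three_cycles :: "'a pair_pre_digraph \<Rightarrow> nat" where
  "num_three_cycles G = card (three_cycle_triples G // rotation_rel)"

definition edge_flip :: "'a pair_pre_digraph \<Rightarrow> 'a pair_pre_digraph \<Rightarrow> bool" where
  "edge_flip G H \<longleftrightarrow>
     (\<exists>i j. (i, j) \<in> parcs G \<and>
        H = G\<lparr>parcs := insert (j, i) (parcs G - {(i, j)})\<rparr>)"

end

theory Submission
  imports Defs
begin

text \<open>
  Reversing an arc \<open>(i, j)\<close> destroys exactly the 3-cycles \<open>i \<rightarrow> j \<rightarrow> k \<rightarrow> i\<close> and creates exactly the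
  3-cycles \<open>j \<rightarrow> i \<rightarrow> k \<rightarrow> j\<close>. So the flip strictly increases the number of 3-cycles as soon as the
  two-step paths from \<open>i\<close> to \<open>j\<close> outnumber those from \<open>j\<close> to \<open>i\<close>
  (\<open>num_three_cycles_less_flip\<close>). If this holds for every arc of a graph that contains a 3-cycle,
  then that graph is a strict local minimum with a positive number of 3-cycles: no admissible
  sequence can make its first step, and the sequence of length zero does not end in a graph
  without 3-cycles.

  Such a graph is the Cayley digraph of \<open>\<int>/39\<close> whose connection set \<open>S\<close> consists of the powers
  of two, \<open>S = {1, 2, 4, 5, 8, 10, 11, 16, 20, 22, 25, 32}\<close>. It is
  oriented because \<open>-1\<close> is not a power of two modulo 39. Translations and multiplications by elements
  of \<open>S\<close> are automorphisms and act transitively on the arcs, so all arcs look like \<open>(0, 1)\<close>.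
  From \<open>0\<close> to \<open>1\<close> there are three two-step paths, since
  \<open>1 = 20 + 20 = 8 + 32 = 32 + 8\<close> are the ways to write \<open>1\<close> as an ordered sum of two elements
  of \<open>S\<close>; from \<open>1\<close> to \<open>0\<close> there are only two, since \<open>-1 = 16 + 22 = 22 + 16\<close> are the ways to write
  \<open>-1\<close>. The latter identities also exhibit 3-cycles.
\<close>

section \<open>The effect of a flip on the number of 3-cycles\<close>

text \<open>
  Each 3-cycle through \<open>(i, j)\<close> has a unique rotation that starts with \<open>i, j\<close>, so it is determined by
  its third vertex. Stating the count for the removal of an arc makes it usable twice for a flip:
  \<open>G\<close> without \<open>(i, j)\<close> is the flipped graph without \<open>(j, i)\<close>.
\<close>

lemma num_three_cycles_remove_arc:
  assumes "pair_digraph G" and arc: "(i, j) \<in> parcs G"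
  shows "num_three_cycles G =
    num_three_cycles (G\<lparr>parcs := parcs G - {(i, j)}\<rparr>) + card {k. (j, k) \<in> parcs G \<and> (k, i) \<in> parcs G}"
proof -
  interpret pair_digraph G by fact
  define G' where "G' = G\<lparr>parcs := parcs G - {(i, j)}\<rparr>"
  define K where "K = {k. (j, k) \<in> parcs G \<and> (k, i) \<in> parcs G}"
  define cls :: "'a \<times> 'a \<times> 'a \<Rightarrow> ('a \<times> 'a \<times> 'a) set" where "cls t = rotation_rel `` {t}" for t
  have cls: "cls (a, b, c) = {(a, b, c), (b, c, a), (c, a, b)}" for a b c
    by (auto simp: cls_def rotation_rel_def)
  have num: "num_three_cycles F = card (cls ` three_cycle_triples F)" for F
    unfolding num_three_cycles_def by (rule arg_cong[where f = card]) (auto simp: quotient_def cls_def)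
  have ij: "i \<noteq> j" and verts: "i \<in> pverts G" "j \<in> pverts G"
    using arc no_loops' in_arcsD1 in_arcsD2 by auto
  have "K \<subseteq> pverts G"
    by (auto simp: K_def dest: in_arcsD1)
  hence "finite K"
    by (rule finite_subset) simp
  have "finite (three_cycle_triples G')"
    by (rule finite_subset[of _ "pverts G \<times> pverts G \<times> pverts G"])
       (auto simp: three_cycle_triples_def G'_def)
  have split: "cls ` three_cycle_triples G =
      cls ` three_cycle_triples G' \<union> (\<lambda>k. cls (i, j, k)) ` K" (is "?A = ?B \<union> ?C")
  proof
    show "?A \<subseteq> ?B \<union> ?C"
    proof
      fix x assume "x \<in> ?A"
      then obtain a b c where x: "x = cls (a, b, c)" and abc: "(a, b, c) \<in> three_cycle_triples G"
        by auto
      show "x \<in> ?B \<union> ?C"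
      proof (cases "(a, b, c) \<in> three_cycle_triples G'")
        case False
        then consider "(a, b) = (i, j)" "c \<in> K" | "(b, c) = (i, j)" "a \<in> K" | "(c, a) = (i, j)" "b \<in> K"
          using abc by (auto simp: three_cycle_triples_def G'_def K_def)
        thus ?thesis
          unfolding x by cases (auto simp: cls image_iff)
      qed (auto simp: x)
    qed
  next
    show "?B \<union> ?C \<subseteq> ?A"
      using verts arc \<open>K \<subseteq> pverts G\<close> by (auto simp: three_cycle_triples_def G'_def K_def)
  qed
  have "inj_on (\<lambda>k. cls (i, j, k)) K"
    using ij by (auto simp: inj_on_def cls)
  moreover have "cls ` three_cycle_triples G' \<inter> (\<lambda>k. cls (i, j, k)) ` K = {}"
  proof -
    have "cls (i, j, k) \<noteq> cls t" if "t \<in> three_cycle_triples G'" for k t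
    proof -
      have "cls t \<subseteq> three_cycle_triples G'"
        using that by (cases t) (auto simp: cls three_cycle_triples_def)
      moreover have "(i, j, k) \<in> cls (i, j, k)" "(i, j, k) \<notin> three_cycle_triples G'"
        by (simp_all add: cls three_cycle_triples_def G'_def)
      ultimately show ?thesis
        by blast
    qed
    thus ?thesis
      by blast
  qed
  ultimately show ?thesis
    unfolding num G'_def[symmetric] K_def[symmetric] split
    using \<open>finite K\<close> \<open>finite (three_cycle_triples G')\<close>
    by (simp add: card_Un_disjoint card_image)
qed

lemma num_three_cycles_less_flip:
  assumes "oriented_graph G" and arc: "(i, j) \<in> parcs G"
    and less: "card {k. (j, k) \<in> parcs G \<and> (k, i) \<in> parcs G} <
               card {k. (i, k) \<in> parcs G \<and> (k, j) \<in> parcs G}"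
  shows "num_three_cycles G < num_three_cycles (G\<lparr>parcs := insert (j, i) (parcs G - {(i, j)})\<rparr>)"
proof -
  interpret oriented_graph G by fact
  let ?H = "G\<lparr>parcs := insert (j, i) (parcs G - {(i, j)})\<rparr>"
  have ji: "(j, i) \<notin> parcs G"
    using arc by (rule no_opposite_arcs)
  have no_loop: "(a, a) \<notin> parcs G" for a
    using no_loops' by auto
  have "pair_digraph ?H"
    using arc no_loop by unfold_locales (auto dest: in_arcsD1 in_arcsD2)
  moreover have "?H\<lparr>parcs := parcs ?H - {(j, i)}\<rparr> = G\<lparr>parcs := parcs G - {(i, j)}\<rparr>"
    using ji by simp
  moreover have "{k. (i, k) \<in> parcs ?H \<and> (k, j) \<in> parcs ?H} =
      {k. (i, k) \<in> parcs G \<and> (k, j) \<in> parcs G}"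
    using arc no_loop by auto
  ultimately have "num_three_cycles ?H = num_three_cycles (G\<lparr>parcs := parcs G - {(i, j)}\<rparr>) +
      card {k. (i, k) \<in> parcs G \<and> (k, j) \<in> parcs G}"
    using num_three_cycles_remove_arc[of ?H j i] by simp
  thus ?thesis
    using num_three_cycles_remove_arc[OF pair_digraph_axioms arc] less by simp
qed

section \<open>The Cayley digraph of the powers of two modulo 39\<close>

definition pow2_residues :: "int set" where
  "pow2_residues = {1, 2, 4, 5, 8, 10, 11, 16, 20, 22, 25, 32}"

definition pow2_digraph :: "nat pair_pre_digraph" where
  "pow2_digraph = \<lparr>pverts = {..<39},
     parcs = {(i, j). i < 39 \<and> j < 39 \<and> (int j - int i) mod 39 \<in> pow2_residues}\<rparr>"

text \<open>
  For an arc from \<open>0\<close> to \<open>s\<close>, the sets below consist of the middle vertices \<open>t\<close> of the two-step paths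
  from \<open>s\<close> to \<open>0\<close> and from \<open>0\<close> to \<open>s\<close>. If \<open>s = 1\<close> they are \<open>{1 + 16, 1 + 22}\<close> and \<open>{8, 20, 32}\<close>, by the
  representations of \<open>-1\<close> and \<open>1\<close> as sums of two powers of two; multiplication by \<open>s\<close> carries
  them to the general case.
\<close>

lemma pow2_residues_sum_counts:
  assumes "s \<in> pow2_residues"
  shows "card {t \<in> {0..<39}. (t - s) mod 39 \<in> pow2_residues \<and> (- t) mod 39 \<in> pow2_residues} <
         card {t \<in> {0..<39}. t \<in> pow2_residues \<and> (s - t) mod 39 \<in> pow2_residues}"
    (is "card ?C < card ?T")
proof -
  have summands: "(- (s + u)) mod 39 \<in> pow2_residues \<longrightarrow> u = 16 * s mod 39 \<or> u = 22 * s mod 39"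
    if "u \<in> pow2_residues" for u
    using assms that unfolding pow2_residues_def by (elim insertE emptyE) simp_all
  have "?C \<subseteq> {17 * s mod 39, 23 * s mod 39}"
  proof
    fix t assume t: "t \<in> ?C"
    define u where "u = (t - s) mod 39"
    have "(- (s + u)) mod 39 = (- t) mod 39"
      by (simp add: u_def mod_simps)
    hence "u = 16 * s mod 39 \<or> u = 22 * s mod 39"
      using summands[of u] t by (auto simp: u_def)
    moreover have "t = (u + s) mod 39"
      using t by (simp add: u_def mod_simps)
    ultimately show "t \<in> {17 * s mod 39, 23 * s mod 39}"
      by (auto simp: mod_simps)
  qed
  hence "card ?C \<le> card {17 * s mod 39, 23 * s mod 39}"
    by (rule card_mono[rotated]) simp
  also have "\<dots> \<le> 2"
    by (simp add: card_insert_if)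
  also have "2 < card {8 * s mod 39, 20 * s mod 39, 32 * s mod 39}"
    using assms by (auto simp: pow2_residues_def)
  also have "\<dots> \<le> card ?T"
  proof (rule card_mono)
    show "finite ?T"
      by (rule finite_subset[of _ "{0..<39}"]) auto
    show "{8 * s mod 39, 20 * s mod 39, 32 * s mod 39} \<subseteq> ?T"
      using assms by (auto simp: pow2_residues_def)
  qed
  finally show ?thesis .
qed

text \<open>Seen from \<open>i\<close>, a vertex is given by its displacement modulo 39.\<close>

lemma card_displacement:
  fixes i :: nat
  shows "card {k. k < 39 \<and> P ((int k - int i) mod 39)} = card {t \<in> {0..<39}. P t}"
proof (rule bij_betw_same_card)
  show "bij_betw (\<lambda>k. (int k - int i) mod 39)
      {k. k < 39 \<and> P ((int k - int i) mod 39)} {t \<in> {0..<39}. P t}"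
  proof (rule bij_betw_byWitness[where f' = "\<lambda>t. nat ((t + int i) mod 39)"])
    show "\<forall>k\<in>{k. k < 39 \<and> P ((int k - int i) mod 39)}. nat (((int k - int i) mod 39 + int i) mod 39) = k"
      by (auto simp: mod_simps)
    show "\<forall>t\<in>{t \<in> {0..<39}. P t}. (int (nat ((t + int i) mod 39)) - int i) mod 39 = t"
      by (auto simp: mod_simps)
    show "(\<lambda>t. nat ((t + int i) mod 39)) ` {t \<in> {0..<39}. P t} \<subseteq>
        {k. k < 39 \<and> P ((int k - int i) mod 39)}"
      by (auto simp: mod_simps nat_less_iff)
  qed auto
qed

lemma pow2_digraph_two_step_paths:
  assumes "(i, j) \<in> parcs pow2_digraph"
  shows "card {k. (j, k) \<in> parcs pow2_digraph \<and> (k, i) \<in> parcs pow2_digraph} <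
         card {k. (i, k) \<in> parcs pow2_digraph \<and> (k, j) \<in> parcs pow2_digraph}"
proof -
  define s where "s = (int j - int i) mod 39"
  have s: "s \<in> pow2_residues" and less: "i < 39" "j < 39"
    using assms by (auto simp: pow2_digraph_def s_def)
  have "{k. (j, k) \<in> parcs pow2_digraph \<and> (k, i) \<in> parcs pow2_digraph} =
      {k. k < 39 \<and> ((int k - int i) mod 39 - s) mod 39 \<in> pow2_residues \<and>
        (- ((int k - int i) mod 39)) mod 39 \<in> pow2_residues}"
    using less by (auto simp: pow2_digraph_def s_def mod_simps)
  moreover have "{k. (i, k) \<in> parcs pow2_digraph \<and> (k, j) \<in> parcs pow2_digraph} =
      {k. k < 39 \<and> (int k - int i) mod 39 \<in> pow2_residues \<and>
        (s - (int k - int i) mod 39) mod 39 \<in> pow2_residues}"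
    using less by (auto simp: pow2_digraph_def s_def mod_simps)
  ultimately show ?thesis
    using pow2_residues_sum_counts[OF s]
      card_displacement[of "\<lambda>t. (t - s) mod 39 \<in> pow2_residues \<and> (- t) mod 39 \<in> pow2_residues" i]
      card_displacement[of "\<lambda>t. t \<in> pow2_residues \<and> (s - t) mod 39 \<in> pow2_residues" i]
    by simp
qed

lemma oriented_graph_pow2_digraph: "oriented_graph pow2_digraph"
proof
  have "0 \<notin> pow2_residues"
    by (simp add: pow2_residues_def)
  thus "fst e \<noteq> snd e" if "e \<in> parcs pow2_digraph" for e
    using that by (auto simp: pow2_digraph_def)
next
  show "finite (parcs pow2_digraph)"
    by (rule finite_subset[of _ "{..<39} \<times> {..<39}"]) (auto simp: pow2_digraph_def)
next
  fix i j assume "(i, j) \<in> parcs pow2_digraph"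
  hence ij: "(int j - int i) mod 39 \<in> pow2_residues"
    by (simp add: pow2_digraph_def)
  have "(- ((int j - int i) mod 39)) mod 39 \<notin> pow2_residues"
    using ij unfolding pow2_residues_def by (elim insertE) auto
  thus "(j, i) \<notin> parcs pow2_digraph"
    by (simp add: pow2_digraph_def mod_simps)
qed (auto simp: pow2_digraph_def)

theorem corollary1:
  shows "\<exists>G :: nat pair_pre_digraph. oriented_graph G \<and>
    \<not> (\<exists>(k :: nat) (Gs :: nat \<Rightarrow> nat pair_pre_digraph).
          Gs 0 = G \<and>
          (\<forall>i<k. edge_flip (Gs i) (Gs (Suc i)) \<and>
                 num_three_cycles (Gs (Suc i)) \<le> num_three_cycles (Gs i)) \<and>
          three_cycle_triples (Gs k) = {})"
proof (intro exI[of _ pow2_digraph] conjI notI oriented_graph_pow2_digraph)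
  assume "\<exists>(k :: nat) (Gs :: nat \<Rightarrow> nat pair_pre_digraph).
          Gs 0 = pow2_digraph \<and>
          (\<forall>i<k. edge_flip (Gs i) (Gs (Suc i)) \<and>
                 num_three_cycles (Gs (Suc i)) \<le> num_three_cycles (Gs i)) \<and>
          three_cycle_triples (Gs k) = {}"
  then obtain k and Gs :: "nat \<Rightarrow> nat pair_pre_digraph"
    where start: "Gs 0 = pow2_digraph"
      and step: "\<forall>i<k. edge_flip (Gs i) (Gs (Suc i)) \<and>
                 num_three_cycles (Gs (Suc i)) \<le> num_three_cycles (Gs i)"
      and no_cycles: "three_cycle_triples (Gs k) = {}"
    by blast
  \<comment> \<open>The differences \<open>1\<close>, \<open>16\<close>, \<open>22\<close> are powers of two modulo 39 and add up to \<open>39\<close>.\<close>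
  have "(0, 1, 17) \<in> three_cycle_triples pow2_digraph"
    by (simp add: three_cycle_triples_def pow2_digraph_def pow2_residues_def)
  hence "k \<noteq> 0"
    using start no_cycles by (metis empty_iff)
  hence flip: "edge_flip pow2_digraph (Gs 1)"
    and le: "num_three_cycles (Gs 1) \<le> num_three_cycles pow2_digraph"
    using start step by force+
  from flip obtain i j where arc: "(i, j) \<in> parcs pow2_digraph"
    and Gs1: "Gs 1 = pow2_digraph\<lparr>parcs := insert (j, i) (parcs pow2_digraph - {(i, j)})\<rparr>"
    unfolding edge_flip_def by blast
  have "num_three_cycles pow2_digraph < num_three_cycles (Gs 1)"
    unfolding Gs1 using oriented_graph_pow2_digraph arc pow2_digraph_two_step_paths[OF arc]
    by (rule num_three_cycles_less_flip)
  with le show False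
    by simp
qed

end
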